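(* Let $f:\mathbb{R}^m\to\mathbb{R}^m$ be differentiable and contractive, i.e. $(x-y,\,f(x)-f(y))\le 0$ for all $x,y$, with $\|f'(y)\|\le L$ for all $y$, for some $L>0$. Let $f_\varepsilon:\mathbb{R}^m\to\mathbb{R}^m$ be any function and set $h=f-f_\varepsilon$. Let $\mathbf{A}=(a_{ij})$ be an invertible $s\times s$ lower triangular real matrix and $\mathbf{b}=(b_i)\in\mathbb{R}^s$, with $\mathbf{B}=\mathrm{diag}(\mathbf{b})$, such that $a_{ii}\ge 0$ and $b_i\ge 0$ for all $i$, the numbers $c_i=\sum_j a_{ij}$ are distinct, and $M=\mathbf{B}\mathbf{A}+\mathbf{A}^T\mathbf{B}-\mathbf{b}\mathbf{b}^T$ is positive semidefinite. Let $\Delta t>0$. Let $z_{n+1}$ be obtained from $z_n$ by one step of the DIRK method, and let $y_{n+1}$ be obtained from $y_n$ by one step of the perturbed DIRK method, with stages $z^{(i)}$ and $y^{(i)}$ respectively (both methods are given in the context). Suppose that $\|h(y^{(i)})\|\le \mathbf{h}_i\le\varepsilon_i\le\varepsilon$ for $i=1,\dots,s$. Then $$\|z_{n+1}-y_{n+1}\|\le \|z_n-y_n\|+\Delta t^2 L\,\Theta+\Delta t\sqrt{2\,\Omega\, L\,\Delta t},$$ where $$\Theta=\sum_{i=1}^s \varepsilon_i b_i a_{ii}\left(1+2\left(\sum_{\ell=1}^{s-1}\left|(\mathbf{A}-\mathbf{\hat A})\mathbf{A}^{-1}\right|^\ell \mathbf{e}\right)_i\right)$$ and $$\Omega=\sum_{i=1}^s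 \varepsilon_i b_i a_{ii}\left(a_{ii}\mathbf{h}_i+2\left(\sum_{\ell=1}^{s-1}\left|(\mathbf{A}-\mathbf{\hat A})\mathbf{A}^{-1}\right|^\ell \mathbf{\hat A}\,\mathbf{h}\right)_i\right).$$ If moreover $\Delta t\ge 2\Omega/(L\Theta^2)$ (with $\Theta>0$, so that the quotient is defined), then $$\|z_{n+1}-y_{n+1}\|\le \|z_n-y_n\|+\Delta t^2 L\,\Theta .$$
   Context: Here $(\cdot,\cdot)$ and $\|\cdot\|$ are the inner product and induced norm on $\mathbb{R}^m$ (with the induced operator norm for $f'$). The DIRK method for $y'=f(y)$ is $$z^{(i)}=z_n+\Delta t\sum_{j=1}^{i}a_{ij}f(z^{(j)}),\quad i=1,\dots,s,\qquad z_{n+1}=z_n+\Delta t\sum_{i=1}^s b_i f(z^{(i)}).$$ The perturbed (mixed accuracy) DIRK method is $$y^{(i)}=y_n+\Delta t\left(\sum_{j=1}^{i-1}a_{ij}f(y^{(j)})+a_{ii}f_\varepsilon(y^{(i)})\right),\quad i=1,\dots,s,\qquad y_{n+1}=y_n+\Delta t\sum_{i=1}^s b_i f(y^{(i)}).$$ The stage values are any vectors satisfying these equations. $\mathbf{\hat A}$ is the diagonal matrix with the same diagonal entries as $\mathbf{A}$, $\mathbf{e}\in\mathbb{R}^s$ is the column vector of ones, $\mathbf{h}=(\mathbf{h}_1,\dots,\mathbf{h}_s)^T$, and for a matrix $|\cdot|$ denotes the componentwise absolute value (so $|\cdot|^\ell$ is the $\ell$-th matrix power of the componentwise absolute value). $(\cdot)_i$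 denotes the $i$-th component of a vector. *)

theory Defs
  imports "HOL-Analysis.Analysis"
begin

text \<open>The stage indices \<open>1, \<dots>, s\<close> are the elements of a finite linearly ordered type
  \<open>'s\<close>, so \<open>s = CARD('s)\<close>, and an \<open>s \<times> s\<close> matrix has type \<open>'s rmat\<close> (that is, \<open>real^'s^'s\<close>).
  The state space is an arbitrary \<^class>\<open>euclidean_space\<close>, i.e. \<open>\<real>\<^sup>m\<close> with an inner product
  and the norm it induces.\<close>

type_synonym 's rvec = "(real, 's) vec"
type_synonym 's rmat = "((real, 's) vec, 's) vec"

definition contractive :: "('a::euclidean_space \<Rightarrow> 'a) \<Rightarrow> bool" where
  "contractive f \<longleftrightarrow> (\<forall>x y. (x - y) \<bullet> (f x - f y) \<le> 0)"

definition lower_triangular :: "('s::{finite,linorder}) rmat \<Rightarrow> bool" where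
  "lower_triangular X \<longleftrightarrow> (\<forall>i j. i < j \<longrightarrow> X $ i $ j = 0)"

text \<open>Only applied to matrices that are symmetric by construction.\<close>

definition positive_semidefinite :: "('s::finite) rmat \<Rightarrow> bool" where
  "positive_semidefinite X \<longleftrightarrow> (\<forall>v. 0 \<le> v \<bullet> (X *v v))"

definition diag_of_vec :: "'s rvec \<Rightarrow> ('s::finite) rmat" where
  "diag_of_vec v = (\<chi> i j. if i = j then v $ i else 0)"

definition diag_part :: "('s::finite) rmat \<Rightarrow> 's rmat" where
  "diag_part X = (\<chi> i j. if i = j then X $ i $ j else 0)"

definition outer_prod :: "'s rvec \<Rightarrow> 's rvec \<Rightarrow> ('s::finite) rmat" where
  "outer_prod u v = (\<chi> i j. u $ i * v $ j)"

text \<open>The power \<open>^\<close> on \<open>real^'s^'s\<close> is the componentwise one, since \<open>*\<close> is.\<close>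

primrec matrix_power :: "('s::finite) rmat \<Rightarrow> nat \<Rightarrow> 's rmat" where
  "matrix_power X 0 = mat 1"
| "matrix_power X (Suc l) = X ** matrix_power X l"

definition dirk_step ::
  "('s::{finite,linorder}) rmat \<Rightarrow> 's rvec \<Rightarrow> real \<Rightarrow> ('a::euclidean_space \<Rightarrow> 'a) \<Rightarrow>
    'a \<Rightarrow> ('s \<Rightarrow> 'a) \<Rightarrow> 'a \<Rightarrow> bool" where
  "dirk_step A b dt f zn z zn1 \<longleftrightarrow>
     (\<forall>i. z i = zn + dt *\<^sub>R (\<Sum>j\<in>{..i}. A $ i $ j *\<^sub>R f (z j))) \<and>
     zn1 = zn + dt *\<^sub>R (\<Sum>i\<in>UNIV. b $ i *\<^sub>R f (z i))"

definition perturbed_dirk_step ::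
  "('s::{finite,linorder}) rmat \<Rightarrow> 's rvec \<Rightarrow> real \<Rightarrow> ('a::euclidean_space \<Rightarrow> 'a) \<Rightarrow> ('a \<Rightarrow> 'a) \<Rightarrow>
    'a \<Rightarrow> ('s \<Rightarrow> 'a) \<Rightarrow> 'a \<Rightarrow> bool" where
  "perturbed_dirk_step A b dt f f\<^sub>\<epsilon> yn y yn1 \<longleftrightarrow>
     (\<forall>i. y i = yn + dt *\<^sub>R ((\<Sum>j\<in>{..<i}. A $ i $ j *\<^sub>R f (y j)) + A $ i $ i *\<^sub>R f\<^sub>\<epsilon> (y i))) \<and>
     yn1 = yn + dt *\<^sub>R (\<Sum>i\<in>UNIV. b $ i *\<^sub>R f (y i))"

text \<open>The absolute value on \<open>real^'s^'s\<close> is componentwise (\<open>abs_vec_def\<close>).\<close>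

definition coupling_matrix :: "('s::finite) rmat \<Rightarrow> 's rmat" where
  "coupling_matrix A = \<bar>(A - diag_part A) ** matrix_inv A\<bar>"

definition coupling_power_sum :: "('s::finite) rmat \<Rightarrow> 's rmat" where
  "coupling_power_sum A = (\<Sum>l\<in>{1..CARD('s) - 1}. matrix_power (coupling_matrix A) l)"

definition Theta :: "('s::finite) rmat \<Rightarrow> 's rvec \<Rightarrow> 's rvec \<Rightarrow> real" where
  "Theta A b \<epsilon> =
     (\<Sum>i\<in>UNIV. \<epsilon> $ i * b $ i * A $ i $ i * (1 + 2 * (coupling_power_sum A *v (\<chi> k. 1)) $ i))"

definition Omega :: "('s::finite) rmat \<Rightarrow> 's rvec \<Rightarrow> 's rvec \<Rightarrow> 's rvec \<Rightarrow> real" where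
  "Omega A b \<epsilon> hb =
     (\<Sum>i\<in>UNIV. \<epsilon> $ i * b $ i * A $ i $ i *
       (A $ i $ i * hb $ i + 2 * (coupling_power_sum A *v (diag_part A *v hb)) $ i))"

end

theory Submission
  imports Defs
begin

text \<open>
  Write \<open>u\<close> for the stage errors \<open>z i - y i\<close>, \<open>w\<close> for \<open>f (z i) - f (y i)\<close> and \<open>r\<close> for
  \<open>norm (zn - yn)\<close>. Expanding \<open>(norm (zn1 - yn1))\<^sup>2\<close> as in Butcher's proof of B-stability,
  contractivity and positive semidefiniteness of \<open>M\<close> remove every term except the pairing of the
  perturbations with \<open>w\<close>, and \<open>norm (w i) \<le> L * norm (u i)\<close>. Contractivity applied to the
  implicit part of a single stage also gives, with \<open>K = coupling_matrix A\<close> strictly lower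
  triangular, \<open>p \<le> q + K (p + q)\<close> for \<open>p = (norm (u i))\<^sub>i\<close> and
  \<open>q = r e + dt (diag_part A) hb\<close>. Since \<open>K\<close> is nilpotent, iterating gives
  \<open>p \<le> (1 + 2 \<Sum> K\<^sup>l) q\<close>, so that
  \<open>(norm (zn1 - yn1))\<^sup>2 \<le> r\<^sup>2 + 2 dt\<^sup>2 L (r \<Theta> + dt \<Omega>)\<close>; both bounds follow by completing
  the square.
\<close>

section \<open>Triangular structure of the coupling matrix\<close>

lemma matrix_inv:
  assumes "invertible A"
  shows "A ** matrix_inv A = mat 1" and "matrix_inv A ** A = mat 1"
proof -
  have "A ** matrix_inv A = mat 1 \<and> matrix_inv A ** A = mat 1"
    unfolding matrix_inv_def using assms unfolding invertible_def by (rule someI_ex)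
  then show "A ** matrix_inv A = mat 1" and "matrix_inv A ** A = mat 1"
    by simp_all
qed

text \<open>Induction on the position of the row, \<open>card {..<i}\<close>. For
  \<open>i \<le> j\<close>, earlier rows of \<open>B\<close> and the upper part of \<open>A\<close>
  kill every term of \<open>(A ** B) $ i $ j\<close> except the diagonal one; the case
  \<open>j = i\<close> shows \<open>A $ i $ i \<noteq> 0\<close>.\<close>

lemma lower_triangular_right_inverse:
  fixes A B :: "('s::{finite,linorder}) rmat"
  assumes low: "lower_triangular A" and inv: "A ** B = mat 1"
  shows "lower_triangular B"
proof -
  have "\<forall>j>i. B $ i $ j = 0" for i
  proof (induction "card {..<i}" arbitrary: i rule: less_induct)
    case less
    have IH: "B $ k $ j = 0" if "k < i" and "k < j" for k j
      using less that by (simp add: psubset_card_mono lessThan_strict_subset_iff)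
    have row: "A $ i $ i * B $ i $ j = (if i = j then 1 else 0)" if "i \<le> j" for j
    proof -
      have "A $ i $ k * B $ k $ j = 0" if "k \<noteq> i" for k
        using that low IH \<open>i \<le> j\<close> unfolding lower_triangular_def
        by (cases "k < i") (auto simp: not_less)
      then have "(\<Sum>k\<in>UNIV - {i}. A $ i $ k * B $ k $ j) = 0"
        by (intro sum.neutral) blast
      then have "(\<Sum>k\<in>UNIV. A $ i $ k * B $ k $ j) = A $ i $ i * B $ i $ j"
        by (subst sum.remove[of _ i]) simp_all
      moreover have "(A ** B) $ i $ j = (if i = j then 1 else 0)"
        by (simp add: inv mat_def)
      ultimately show ?thesis
        by (simp add: matrix_matrix_mult_def)
    qed
    have "A $ i $ i \<noteq> 0"
      using row[of i] by auto
    then show ?case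
      using row by (metis less_imp_le mult_eq_0_iff order_less_irrefl)
  qed
  then show ?thesis
    by (simp add: lower_triangular_def)
qed

text \<open>A nonzero term needs \<open>k < i\<close> from the strictly lower factor and
  \<open>j \<le> k\<close> from the lower triangular inverse.\<close>

lemma coupling_matrix_strictly_lower:
  fixes A :: "('s::{finite,linorder}) rmat"
  assumes low: "lower_triangular A" and inv: "invertible A" and ij: "i \<le> j"
  shows "coupling_matrix A $ i $ j = 0"
proof -
  have "lower_triangular (matrix_inv A)"
    using lower_triangular_right_inverse[OF low] matrix_inv(1)[OF inv] by blast
  then have "(A - diag_part A) $ i $ k * matrix_inv A $ k $ j = 0" for k
    using low ij unfolding lower_triangular_def diag_part_def
    by (cases "k < i") (auto simp: not_less order_le_less)
  then have "((A - diag_part A) ** matrix_inv A) $ i $ j = 0"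
    unfolding matrix_matrix_mult_def vec_lambda_beta by (intro sum.neutral ballI)
  then show ?thesis
    by (simp add: coupling_matrix_def abs_vec_def)
qed

lemma coupling_matrix_nonneg: "0 \<le> coupling_matrix A $ i $ j"
  by (simp add: coupling_matrix_def abs_vec_def)

section \<open>Powers of strictly lower triangular matrices\<close>

lemma matrix_power_nonneg:
  assumes "\<And>i j. 0 \<le> K $ i $ j"
  shows "0 \<le> matrix_power K l $ i $ j"
  by (induction l arbitrary: i j)
    (auto simp: mat_def matrix_matrix_mult_def assms intro!: sum_nonneg)

lemma matrix_power_commute: "matrix_power K l ** K = K ** matrix_power K l"
  by (induction l) (simp_all flip: matrix_mul_assoc)

text \<open>The number \<open>card {..<i}\<close> is the rank of \<open>i\<close> in the order. Each
  factor \<open>K\<close> forces a strict descent of the index, so \<open>l\<close> factors lower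
  the rank by at least \<open>l\<close>.\<close>

lemma matrix_power_strictly_lower_rank:
  fixes K :: "('s::{finite,linorder}) rmat"
  assumes K: "\<And>i j. i \<le> j \<Longrightarrow> K $ i $ j = 0"
  shows "matrix_power K l $ i $ j \<noteq> 0 \<Longrightarrow> card {..<j} + l \<le> card {..<i}"
proof (induction l arbitrary: i)
  case 0
  then show ?case
    by (simp add: mat_def split: if_splits)
next
  case (Suc l)
  then obtain k where k: "K $ i $ k \<noteq> 0" "matrix_power K l $ k $ j \<noteq> 0"
    by (auto simp: matrix_matrix_mult_def elim!: sum.not_neutral_contains_not_neutral)
  have "k < i"
    using K k(1) by (meson not_le)
  then have "card {..<k} < card {..<i}"
    by (intro psubset_card_mono) auto
  with Suc.IH[OF k(2)] show ?case
    by simp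
qed

lemma matrix_power_strictly_lower_nilpotent:
  fixes K :: "('s::{finite,linorder}) rmat"
  assumes "\<And>i j. i \<le> j \<Longrightarrow> K $ i $ j = 0"
  shows "matrix_power K CARD('s) = 0"
proof -
  have "card {..<i} < CARD('s)" for i :: 's
    by (intro psubset_card_mono) auto
  then have "\<not> card {..<j} + CARD('s) \<le> card {..<i}" for i j :: 's
    by (simp add: not_le trans_less_add2)
  then have "matrix_power K CARD('s) $ i $ j = 0" for i j
    using matrix_power_strictly_lower_rank[OF assms] by blast
  then show ?thesis
    by (simp add: vec_eq_iff)
qed

lemma matrix_vector_mult_mono:
  fixes K :: "('s::finite) rmat"
  assumes "\<And>i j. 0 \<le> K $ i $ j" and "x \<le> y"
  shows "K *v x \<le> K *v y"
  using assms by (auto simp: less_eq_vec_def matrix_vector_mult_def intro!: sum_mono mult_left_mono)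

text \<open>Adding \<open>q\<close> to the hypothesis gives
  \<open>p + q \<le> 2q + K (p + q)\<close>. Each substitution of this into the remainder yields one
  more term \<open>2 K^l q\<close>, until nilpotency kills the remainder.\<close>

lemma nilpotent_comparison:
  fixes K :: "('s::{finite,linorder}) rmat"
  assumes nonneg: "\<And>i j. 0 \<le> K $ i $ j"
    and lower: "\<And>i j. i \<le> j \<Longrightarrow> K $ i $ j = 0"
    and p: "p \<le> q + K *v (p + q)"
  shows "p \<le> q + 2 *\<^sub>R ((\<Sum>l\<in>{1..CARD('s) - 1}. matrix_power K l) *v q)"
proof -
  let ?S = "\<lambda>n. \<Sum>l\<in>{1..n}. matrix_power K l"
  have iter: "p \<le> q + 2 *\<^sub>R (?S n *v q) + matrix_power K (Suc n) *v (p + q)" for n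
  proof (induction n)
    case 0
    show ?case
      using p by simp
  next
    case (Suc n)
    let ?P = "matrix_power K (Suc n)"
    have "?P *v (p + q) \<le> ?P *v (2 *\<^sub>R q + K *v (p + q))"
      using add_right_mono[OF p, of q]
      by (intro matrix_vector_mult_mono matrix_power_nonneg nonneg) (simp add: scaleR_2 ac_simps)
    \<comment> \<open>Here \<open>K\<close> is appended on the right, whereas
      \<open>matrix_power\<close> multiplies on the left, hence the commutation rule.\<close>
    also have "\<dots> = 2 *\<^sub>R (?P *v q) + matrix_power K (Suc (Suc n)) *v (p + q)"
      by (simp only: matrix_vector_right_distrib matrix_vector_mult_scaleR
          matrix_vector_mul_assoc matrix_power_commute matrix_power.simps(2)[of K "Suc n"])
    finally have "q + 2 *\<^sub>R (?S n *v q) + ?P *v (p + q)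
        \<le> q + 2 *\<^sub>R (?S n *v q) + (2 *\<^sub>R (?P *v q) + matrix_power K (Suc (Suc n)) *v (p + q))"
      by (rule add_left_mono)
    also have "\<dots> = q + 2 *\<^sub>R (?S (Suc n) *v q) + matrix_power K (Suc (Suc n)) *v (p + q)"
      by (simp only: sum.cl_ivl_Suc) (simp add: matrix_vector_mult_add_rdistrib scaleR_add_right)
    finally show ?case
      using Suc by (rule order_trans[rotated])
  qed
  \<comment> \<open>The truncated subtraction is harmless because a type is nonempty.\<close>
  have "Suc (CARD('s) - 1) = CARD('s)"
    by simp
  then show ?thesis
    using iter[of "CARD('s) - 1"] matrix_power_strictly_lower_nilpotent[OF lower]
    by (simp del: matrix_power.simps)
qed

section \<open>Inner products and algebraic stability\<close>

text \<open>Evaluate the quadratic form in each coordinate of the state space separately.\<close>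

lemma positive_semidefinite_sum_inner:
  fixes w :: "'s::finite \<Rightarrow> 'a::euclidean_space" and M :: "('s::finite) rmat"
  assumes "positive_semidefinite M"
  shows "0 \<le> (\<Sum>i\<in>UNIV. \<Sum>j\<in>UNIV. M $ i $ j * (w i \<bullet> w j))"
proof -
  have "0 \<le> (\<Sum>i\<in>UNIV. \<Sum>j\<in>UNIV. M $ i $ j * ((w i \<bullet> e) * (w j \<bullet> e)))" for e
    using assms[unfolded positive_semidefinite_def, rule_format, of "\<chi> i. w i \<bullet> e"]
    by (simp add: inner_vec_def matrix_vector_mult_def sum_distrib_left mult_ac)
  then have "0 \<le> (\<Sum>e\<in>Basis. \<Sum>i\<in>UNIV. \<Sum>j\<in>UNIV. M $ i $ j * ((w i \<bullet> e) * (w j \<bullet> e)))"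
    by (rule sum_nonneg)
  also have "\<dots> = (\<Sum>i\<in>UNIV. \<Sum>j\<in>UNIV. \<Sum>e\<in>Basis. M $ i $ j * ((w i \<bullet> e) * (w j \<bullet> e)))"
    by (subst sum.swap) (intro sum.cong refl sum.swap)
  also have "\<dots> = (\<Sum>i\<in>UNIV. \<Sum>j\<in>UNIV. M $ i $ j * (w i \<bullet> w j))"
    by (simp add: euclidean_inner[of "w _" "w _"] sum_distrib_left)
  finally show ?thesis .
qed

text \<open>This lets the implicit term of a stage move to the left-hand side without loss: pairing
  \<open>u - c w\<close> with \<open>u\<close> can only increase on
  \<open>u \<bullet> u\<close>.\<close>

lemma norm_le_norm_diff_scaleR:
  fixes u w :: "'a::real_inner"
  assumes "u \<bullet> w \<le> 0" and "0 \<le> c"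
  shows "norm u \<le> norm (u - c *\<^sub>R w)"
proof -
  have "norm u * norm u \<le> u \<bullet> (u - c *\<^sub>R w)"
    using mult_nonneg_nonpos[OF assms(2,1)]
    by (simp add: inner_diff_right power2_norm_eq_inner flip: power2_eq_square)
  also have "\<dots> \<le> norm u * norm (u - c *\<^sub>R w)"
    by (rule norm_cauchy_schwarz)
  finally show ?thesis
    by (cases "u = 0") auto
qed

text \<open>Expand the square and use the stage equation to replace \<open>u0\<close> by
  \<open>u i\<close> in the cross terms \<open>u0 \<bullet> w i\<close>. The leftover double sums,
  \<open>2 * Q - R\<close>, form the quadratic form of \<open>M\<close>.\<close>

lemma algebraic_stability_identity:
  fixes A :: "('s::finite) rmat" and u w d :: "'s \<Rightarrow> 'a::real_inner"
  assumes stage: "\<And>i. u i = u0 + dt *\<^sub>R (\<Sum>j\<in>UNIV. A $ i $ j *\<^sub>R w j) + dt *\<^sub>R d i"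
  shows "(norm (u0 + dt *\<^sub>R (\<Sum>i\<in>UNIV. b $ i *\<^sub>R w i)))\<^sup>2 =
    (norm u0)\<^sup>2 + 2 * dt * (\<Sum>i\<in>UNIV. b $ i * (u i \<bullet> w i))
     - 2 * dt\<^sup>2 * (\<Sum>i\<in>UNIV. b $ i * (d i \<bullet> w i))
     - dt\<^sup>2 * (\<Sum>i\<in>UNIV. \<Sum>j\<in>UNIV.
         (diag_of_vec b ** A + transpose A ** diag_of_vec b - outer_prod b b) $ i $ j * (w i \<bullet> w j))"
proof -
  define Q where "Q = (\<Sum>i\<in>UNIV. \<Sum>j\<in>UNIV. b $ i * A $ i $ j * (w i \<bullet> w j))"
  define R where "R = (\<Sum>i\<in>UNIV. \<Sum>j\<in>UNIV. b $ i * b $ j * (w i \<bullet> w j))"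
  have M: "(diag_of_vec b ** A + transpose A ** diag_of_vec b - outer_prod b b) $ i $ j
      = b $ i * A $ i $ j + b $ j * A $ j $ i - b $ i * b $ j" for i j
    by (simp add: diag_of_vec_def outer_prod_def matrix_matrix_mult_def transpose_def
        if_distrib[of "\<lambda>x. x * _"] if_distrib[of "\<lambda>x. _ * x"] cong: if_cong)
  have "(\<Sum>i\<in>UNIV. \<Sum>j\<in>UNIV. b $ j * A $ j $ i * (w i \<bullet> w j)) = Q"
    unfolding Q_def by (subst sum.swap) (simp add: inner_commute)
  then have MQ: "(\<Sum>i\<in>UNIV. \<Sum>j\<in>UNIV.
      (diag_of_vec b ** A + transpose A ** diag_of_vec b - outer_prod b b) $ i $ j * (w i \<bullet> w j))
      = 2 * Q - R"
    unfolding M by (simp add: Q_def R_def algebra_simps sum.distrib sum_subtractf)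
  have "b $ i * (u i \<bullet> w i) = b $ i * (u0 \<bullet> w i)
      + dt * (\<Sum>j\<in>UNIV. b $ i * A $ i $ j * (w i \<bullet> w j)) + dt * (b $ i * (d i \<bullet> w i))" for i
    by (simp add: stage inner_add_left inner_sum_left sum_distrib_left inner_commute[of "w i"]
        algebra_simps)
  then have uw: "(\<Sum>i\<in>UNIV. b $ i * (u i \<bullet> w i)) =
      (\<Sum>i\<in>UNIV. b $ i * (u0 \<bullet> w i)) + dt * Q + dt * (\<Sum>i\<in>UNIV. b $ i * (d i \<bullet> w i))"
    by (simp add: Q_def sum.distrib sum_distrib_left)
  have "(norm (u0 + dt *\<^sub>R (\<Sum>i\<in>UNIV. b $ i *\<^sub>R w i)))\<^sup>2
      = (norm u0)\<^sup>2 + 2 * dt * (\<Sum>i\<in>UNIV. b $ i * (u0 \<bullet> w i)) + dt\<^sup>2 * R"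
  proof -
    have "(norm (\<Sum>i\<in>UNIV. b $ i *\<^sub>R w i))\<^sup>2 = R"
      by (simp add: power2_norm_eq_inner R_def inner_sum_left inner_sum_right sum_distrib_left
          inner_commute mult_ac)
    moreover have "(norm (u0 + dt *\<^sub>R v))\<^sup>2 = (norm u0)\<^sup>2 + 2 * dt * (u0 \<bullet> v) + dt\<^sup>2 * (norm v)\<^sup>2" for v
      unfolding power2_norm_eq_inner
      by (simp add: inner_add_left inner_add_right inner_commute[of v u0] power2_eq_square algebra_simps)
    ultimately show ?thesis
      by (simp add: inner_sum_right)
  qed
  then show ?thesis
    unfolding MQ uw by (simp add: algebra_simps power2_eq_square)
qed

section \<open>Recursion for the stage errors\<close>

text \<open>The strictly lower part of \<open>A\<close> acts on the increments \<open>w\<close>; writing it as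
  \<open>((A - diag_part A) ** matrix_inv A) ** A\<close> trades \<open>w\<close> for stage errors, so no Lipschitz
  constant enters.\<close>

lemma stage_error_recursion:
  fixes A :: "('s::finite) rmat" and u w d :: "'s \<Rightarrow> 'a::real_inner"
  assumes inv: "invertible A" and diag: "\<And>i. 0 \<le> A $ i $ i" and dt: "0 \<le> dt"
    and uw: "\<And>i. u i \<bullet> w i \<le> 0" and d: "\<And>i. norm (d i) \<le> hb $ i"
    and stage: "\<And>i. u i = u0 + dt *\<^sub>R (\<Sum>j\<in>UNIV. A $ i $ j *\<^sub>R w j) + dt *\<^sub>R A $ i $ i *\<^sub>R d i"
    and p_def: "p = (\<chi> i. norm (u i))"
    and q_def: "q = norm u0 *\<^sub>R (\<chi> k. 1) + dt *\<^sub>R (diag_part A *v hb)"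
  shows "p \<le> q + coupling_matrix A *v (p + q)"
proof -
  define C where "C = (A - diag_part A) ** matrix_inv A"
  have CA: "C ** A = A - diag_part A"
    using matrix_inv(2)[OF inv] by (simp add: C_def flip: matrix_mul_assoc)
  \<comment> \<open>Stripped of initial error and perturbation, a stage error is \<open>dt\<close>
    times row \<open>k\<close> of \<open>A\<close> applied to \<open>w\<close>; applying
    \<open>C\<close> then leaves only the explicit part.\<close>
  define g where "g k = u k - u0 - dt *\<^sub>R A $ k $ k *\<^sub>R d k" for k
  have q: "q $ i = norm u0 + dt * (A $ i $ i * hb $ i)" for i
    by (simp add: q_def diag_part_def matrix_vector_mult_def if_distrib[of "\<lambda>x. x * _"] cong: if_cong)
  have dq: "norm u0 + norm (dt *\<^sub>R A $ i $ i *\<^sub>R d i) \<le> q $ i" for i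
    using d diag dt by (simp add: q mult.assoc mult_left_mono)
  have g: "g k = dt *\<^sub>R (\<Sum>j\<in>UNIV. A $ k $ j *\<^sub>R w j)" for k
    by (simp add: g_def stage)
  have g_le: "norm (g k) \<le> (p + q) $ k" for k
  proof -
    have "norm (g k) \<le> norm (u k) + norm u0 + norm (dt *\<^sub>R A $ k $ k *\<^sub>R d k)"
      unfolding g_def by (intro order_trans[OF norm_triangle_ineq4] add_right_mono norm_triangle_ineq4)
    then show ?thesis
      using dq[of k] by (simp add: p_def)
  qed
  have Cg: "(\<Sum>k\<in>UNIV. C $ i $ k *\<^sub>R g k) =
      dt *\<^sub>R (\<Sum>j\<in>UNIV. A $ i $ j *\<^sub>R w j) - (dt * A $ i $ i) *\<^sub>R w i" for i
  proof -
    have "(\<Sum>k\<in>UNIV. C $ i $ k *\<^sub>R g k) = dt *\<^sub>R (\<Sum>k\<in>UNIV. \<Sum>j\<in>UNIV. (C $ i $ k * A $ k $ j) *\<^sub>R w j)"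
      by (simp add: g scaleR_sum_right mult_ac)
    also have "\<dots> = dt *\<^sub>R (\<Sum>j\<in>UNIV. (C ** A) $ i $ j *\<^sub>R w j)"
      by (subst sum.swap) (simp add: matrix_matrix_mult_def scaleR_sum_left)
    also have "\<dots> = dt *\<^sub>R (\<Sum>j\<in>UNIV. A $ i $ j *\<^sub>R w j - (if i = j then A $ i $ i *\<^sub>R w i else 0))"
      unfolding CA by (intro arg_cong[where f = "scaleR dt"] sum.cong)
        (auto simp: diag_part_def scaleR_diff_left)
    finally show ?thesis
      by (simp add: sum_subtractf scaleR_diff_right)
  qed
  have "p $ i \<le> (q + coupling_matrix A *v (p + q)) $ i" for i
  proof -
    \<comment> \<open>Subtracting the implicit part leaves initial error, perturbation and explicit
      part, each controlled by \<open>p\<close> and \<open>q\<close>.\<close>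
    have "p $ i \<le> norm (u i - (dt * A $ i $ i) *\<^sub>R w i)"
      unfolding p_def using norm_le_norm_diff_scaleR[OF uw[of i]] diag dt by simp
    also have "u i - (dt * A $ i $ i) *\<^sub>R w i
        = u0 + dt *\<^sub>R A $ i $ i *\<^sub>R d i + (\<Sum>k\<in>UNIV. C $ i $ k *\<^sub>R g k)"
      unfolding Cg by (subst stage) simp
    also have "norm \<dots> \<le> q $ i + norm (\<Sum>k\<in>UNIV. C $ i $ k *\<^sub>R g k)"
      using dq[of i] by (intro norm_triangle_le add_right_mono order_trans[OF norm_triangle_ineq])
    also have "norm (\<Sum>k\<in>UNIV. C $ i $ k *\<^sub>R g k) \<le> (\<Sum>k\<in>UNIV. \<bar>C $ i $ k\<bar> * (p + q) $ k)"
      by (intro sum_norm_le) (use g_le in \<open>auto intro!: mult_left_mono simp del: vector_add_component\<close>)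
    finally show ?thesis
      by (simp add: coupling_matrix_def abs_vec_def matrix_vector_mult_def flip: C_def)
  qed
  then show ?thesis
    by (simp add: less_eq_vec_def)
qed

section \<open>One-step error bounds\<close>

theorem theorem1:
  fixes f f\<^sub>\<epsilon> h :: "'a::euclidean_space \<Rightarrow> 'a"
    and A :: "('s::{finite,linorder}) rmat"
    and b hb \<epsilon> :: "'s rvec"
    and \<epsilon>\<^sub>0 L dt :: real
    and zn zn1 yn yn1 :: 'a
    and z y :: "'s \<Rightarrow> 'a"
  assumes f_diff: "\<forall>x. f differentiable (at x)"
    and f_contr: "contractive f"
    and L_pos: "L > 0"
    and f_bound: "\<forall>x. onorm (frechet_derivative f (at x)) \<le> L"
    and h_def: "h = (\<lambda>x. f x - f\<^sub>\<epsilon> x)"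
    and A_inv: "invertible A"
    and A_lower: "lower_triangular A"
    and A_diag: "\<forall>i. A $ i $ i \<ge> 0"
    and b_nonneg: "\<forall>i. b $ i \<ge> 0"
    and c_distinct: "inj (\<lambda>i. \<Sum>j\<in>UNIV. A $ i $ j)"
    and M_psd: "positive_semidefinite
                  (diag_of_vec b ** A + transpose A ** diag_of_vec b - outer_prod b b)"
    and dt_pos: "dt > 0"
    and z_step: "dirk_step A b dt f zn z zn1"
    and y_step: "perturbed_dirk_step A b dt f f\<^sub>\<epsilon> yn y yn1"
    and h_bound: "\<forall>i. norm (h (y i)) \<le> hb $ i \<and> hb $ i \<le> \<epsilon> $ i \<and> \<epsilon> $ i \<le> \<epsilon>\<^sub>0"
  shows "norm (zn1 - yn1) \<le> norm (zn - yn) + dt\<^sup>2 * L * Theta A b \<epsilon>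
             + dt * sqrt (2 * Omega A b \<epsilon> hb * L * dt)
         \<and> (Theta A b \<epsilon> > 0 \<and> dt \<ge> 2 * Omega A b \<epsilon> hb / (L * (Theta A b \<epsilon>)\<^sup>2) \<longrightarrow>
              norm (zn1 - yn1) \<le> norm (zn - yn) + dt\<^sup>2 * L * Theta A b \<epsilon>)"
proof -
  define r where "r = norm (zn - yn)"
  define u where "u i = z i - y i" for i
  define w where "w i = f (z i) - f (y i)" for i
  define d where "d i = h (y i)" for i
  define p where "p = (\<chi> i. norm (u i))"
  define q where "q = r *\<^sub>R (\<chi> k. 1) + dt *\<^sub>R (diag_part A *v hb)"
  define S where "S = coupling_power_sum A"
  let ?T = "Theta A b \<epsilon>" and ?O = "Omega A b \<epsilon> hb"
  have hb: "norm (d i) \<le> hb $ i" "0 \<le> hb $ i" "hb $ i \<le> \<epsilon> $ i" "0 \<le> \<epsilon> $ i" for i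
    using h_bound norm_ge_zero[of "h (y i)"] unfolding d_def by (meson order_trans)+
  have diag: "(diag_part A *v v) $ i = A $ i $ i * v $ i" for v :: "'s rvec" and i
    by (simp add: diag_part_def matrix_vector_mult_def if_distrib[of "\<lambda>x. x * _"] cong: if_cong)
  have uw: "u i \<bullet> w i \<le> 0" for i
    using f_contr by (simp add: contractive_def u_def w_def)
  have lip: "norm (w i) \<le> L * norm (u i)" for i
    unfolding u_def w_def
    by (rule differentiable_bound[where S = UNIV and f' = "\<lambda>x. frechet_derivative f (at x)"])
      (use f_diff f_bound in \<open>auto simp: frechet_derivative_works[symmetric]\<close>)
  \<comment> \<open>Since the perturbed function is \<open>f - h\<close>, the perturbation enters
    the difference with a plus sign.\<close>
  have stage: "u i = (zn - yn) + dt *\<^sub>R (\<Sum>j\<in>UNIV. A $ i $ j *\<^sub>R w j) + dt *\<^sub>R A $ i $ i *\<^sub>R d i" for i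
  proof -
    have full: "(\<Sum>j\<in>UNIV. A $ i $ j *\<^sub>R w j) = (\<Sum>j\<in>{..i}. A $ i $ j *\<^sub>R w j)"
      using A_lower by (intro sum.mono_neutral_right) (auto simp: lower_triangular_def)
    have split: "(\<Sum>j\<in>{..i}. A $ i $ j *\<^sub>R g j) = (\<Sum>j\<in>{..<i}. A $ i $ j *\<^sub>R g j) + A $ i $ i *\<^sub>R g i"
      for g :: "'s \<Rightarrow> 'a"
      by (simp add: ivl_disj_un(2)[symmetric] add.commute)
    have "u i = (zn + dt *\<^sub>R (\<Sum>j\<in>{..i}. A $ i $ j *\<^sub>R f (z j)))
        - (yn + dt *\<^sub>R ((\<Sum>j\<in>{..<i}. A $ i $ j *\<^sub>R f (y j)) + A $ i $ i *\<^sub>R f\<^sub>\<epsilon> (y i)))"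
      using z_step y_step unfolding u_def dirk_step_def perturbed_dirk_step_def by metis
    also have "\<dots> = (zn - yn) + dt *\<^sub>R ((\<Sum>j\<in>{..i}. A $ i $ j *\<^sub>R f (z j))
        - (\<Sum>j\<in>{..i}. A $ i $ j *\<^sub>R f (y j))) + dt *\<^sub>R A $ i $ i *\<^sub>R d i"
      unfolding split[of "\<lambda>j. f (y j)"] by (simp add: d_def h_def algebra_simps)
    finally show ?thesis
      unfolding full by (simp add: w_def scaleR_diff_right sum_subtractf)
  qed
  have final: "zn1 - yn1 = (zn - yn) + dt *\<^sub>R (\<Sum>i\<in>UNIV. b $ i *\<^sub>R w i)"
  proof -
    have "zn1 = zn + dt *\<^sub>R (\<Sum>i\<in>UNIV. b $ i *\<^sub>R f (z i))"
      and "yn1 = yn + dt *\<^sub>R (\<Sum>i\<in>UNIV. b $ i *\<^sub>R f (y i))"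
      using z_step y_step unfolding dirk_step_def perturbed_dirk_step_def by blast+
    then show ?thesis
      by (simp add: w_def scaleR_diff_right sum_subtractf)
  qed
  have "p \<le> q + coupling_matrix A *v (p + q)"
    using stage_error_recursion[OF A_inv _ _ uw hb(1) stage p_def] A_diag dt_pos
    unfolding q_def r_def by simp
  then have "p \<le> q + 2 *\<^sub>R (S *v q)"
    unfolding S_def coupling_power_sum_def
    by (intro nilpotent_comparison coupling_matrix_nonneg coupling_matrix_strictly_lower A_lower A_inv)
  \<comment> \<open>Linearity in \<open>q\<close> separates the part proportional to
    \<open>r\<close>, which becomes \<open>Theta\<close>, from the part proportional to
    \<open>dt\<close>, which becomes \<open>Omega\<close>.\<close>
  then have p_le: "norm (u i) \<le> r * (1 + 2 * (S *v (\<chi> k. 1)) $ i)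
      + dt * (A $ i $ i * hb $ i + 2 * (S *v (diag_part A *v hb)) $ i)" for i
    by (simp add: less_eq_vec_def p_def q_def diag matrix_vector_right_distrib
        matrix_vector_mult_scaleR algebra_simps)
  have S_nonneg: "0 \<le> (S *v v) $ i" if "\<And>k. 0 \<le> v $ k" for v i
    unfolding S_def coupling_power_sum_def matrix_vector_mult_def
    using that by (auto intro!: sum_nonneg mult_nonneg_nonneg matrix_power_nonneg coupling_matrix_nonneg)
  have T_nonneg: "0 \<le> ?T" and O_nonneg: "0 \<le> ?O"
    unfolding Theta_def Omega_def S_def[symmetric] using A_diag b_nonneg hb
    by (auto intro!: sum_nonneg mult_nonneg_nonneg add_nonneg_nonneg S_nonneg simp: diag)

  \<comment> \<open>The perturbation is bounded by \<open>\<epsilon> $ i\<close> here but by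
    \<open>hb\<close> inside \<open>norm (u i)\<close>, which explains the mixed products in
    \<open>Omega\<close>.\<close>
  have pert_i: "- (b $ i * ((A $ i $ i *\<^sub>R d i) \<bullet> w i)) \<le> L * (\<epsilon> $ i * b $ i * A $ i $ i * norm (u i))" for i
  proof -
    have "- (d i \<bullet> w i) \<le> norm (d i) * norm (w i)"
      using norm_cauchy_schwarz[of "- d i" "w i"] by simp
    also have "\<dots> \<le> \<epsilon> $ i * (L * norm (u i))"
      using hb[of i] lip[of i] by (intro mult_mono) auto
    finally have "(b $ i * A $ i $ i) * - (d i \<bullet> w i) \<le> (b $ i * A $ i $ i) * (\<epsilon> $ i * (L * norm (u i)))"
      using A_diag b_nonneg by (intro mult_left_mono) auto
    then show ?thesis
      by (simp add: algebra_simps)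
  qed
  have "- (\<Sum>i\<in>UNIV. b $ i * ((A $ i $ i *\<^sub>R d i) \<bullet> w i))
      \<le> L * (\<Sum>i\<in>UNIV. \<epsilon> $ i * b $ i * A $ i $ i * norm (u i))"
    unfolding sum_negf[symmetric] sum_distrib_left by (intro sum_mono pert_i)
  also have "\<dots> \<le> L * (\<Sum>i\<in>UNIV. \<epsilon> $ i * b $ i * A $ i $ i *
      (r * (1 + 2 * (S *v (\<chi> k. 1)) $ i)
      + dt * (A $ i $ i * hb $ i + 2 * (S *v (diag_part A *v hb)) $ i)))"
    using L_pos A_diag b_nonneg hb by (intro mult_left_mono sum_mono p_le) auto
  also have "\<dots> = L * (r * ?T + dt * ?O)"
    unfolding Theta_def Omega_def S_def[symmetric] sum_distrib_left sum.distrib[symmetric]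
    by (intro arg_cong[where f = "(*) L"] sum.cong refl) (simp add: algebra_simps)
  finally have pert: "dt\<^sup>2 * - (\<Sum>i\<in>UNIV. b $ i * ((A $ i $ i *\<^sub>R d i) \<bullet> w i)) \<le> dt\<^sup>2 * (L * (r * ?T + dt * ?O))"
    by (intro mult_left_mono) auto
  have "dt * (\<Sum>i\<in>UNIV. b $ i * (u i \<bullet> w i)) \<le> 0"
    using dt_pos b_nonneg uw by (intro mult_nonneg_nonpos sum_nonpos) auto
  moreover have "0 \<le> dt\<^sup>2 * (\<Sum>i\<in>UNIV. \<Sum>j\<in>UNIV.
      (diag_of_vec b ** A + transpose A ** diag_of_vec b - outer_prod b b) $ i $ j * (w i \<bullet> w j))"
    by (intro mult_nonneg_nonneg positive_semidefinite_sum_inner M_psd) auto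
  ultimately have sq: "(norm (zn1 - yn1))\<^sup>2 \<le> r\<^sup>2 + 2 * (dt\<^sup>2 * (L * (r * ?T + dt * ?O)))"
    using pert algebraic_stability_identity[OF stage, of b] unfolding final r_def by simp

  \<comment> \<open>With these choices the estimate reads \<open>r^2 + 2 r X + Y^2\<close>, which
    differs from \<open>(r + X + Y)^2\<close> by nonnegative terms.\<close>
  define X where "X = dt\<^sup>2 * L * ?T"
  define Y where "Y = dt * sqrt (2 * ?O * L * dt)"
  have nonneg: "0 \<le> r" "0 \<le> X" "0 \<le> Y"
    using L_pos T_nonneg O_nonneg dt_pos by (auto simp: r_def X_def Y_def)
  have Y2: "Y\<^sup>2 = 2 * (dt\<^sup>2 * (L * (dt * ?O)))"
    using L_pos O_nonneg dt_pos by (simp add: Y_def power_mult_distrib)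
  have sqXY: "(norm (zn1 - yn1))\<^sup>2 \<le> r\<^sup>2 + 2 * r * X + Y\<^sup>2"
    using sq unfolding Y2 X_def by (simp add: algebra_simps)
  have "(norm (zn1 - yn1))\<^sup>2 \<le> (r + X + Y)\<^sup>2"
    by (rule order_trans[OF sqXY]) (use nonneg in \<open>simp add: power2_eq_square algebra_simps\<close>)
  then have "norm (zn1 - yn1) \<le> r + X + Y"
    by (rule power2_le_imp_le) (use nonneg in simp)
  moreover have "norm (zn1 - yn1) \<le> r + X" if T: "?T > 0" and le: "dt \<ge> 2 * ?O / (L * ?T\<^sup>2)"
  proof -
    have "2 * ?O \<le> dt * (L * ?T\<^sup>2)"
      using le T L_pos by (simp add: pos_divide_le_eq)
    \<comment> \<open>The step size condition amounts to \<open>Y^2 \<le> X^2\<close>; this factor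
      turns its two sides into these squares, and \<open>Y^2\<close> can then be absorbed into
      \<open>(r + X)^2\<close>.\<close>
    then have "(dt\<^sup>2 * L * dt) * (2 * ?O) \<le> (dt\<^sup>2 * L * dt) * (dt * (L * ?T\<^sup>2))"
      using L_pos dt_pos by (intro mult_left_mono) auto
    then have "Y\<^sup>2 \<le> X\<^sup>2"
      unfolding Y2 X_def by (simp add: power2_eq_square mult_ac)
    then have "(norm (zn1 - yn1))\<^sup>2 \<le> (r + X)\<^sup>2"
      using sqXY by (simp add: power2_sum)
    then show ?thesis
      by (rule power2_le_imp_le) (use nonneg in simp)
  qed
  ultimately show ?thesis
    unfolding r_def X_def Y_def by simp
qed

end
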